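(* Let $\mathcal F\subseteq\omega^\omega$ and let $\mathcal I,\mathcal J$ be ideals on $\omega$ such that $\mathcal I$ is tall and $\mathcal I\not\le_{\mathcal F}\mathcal J\restriction A$ for all $A\notin\mathcal J$. Then: (1) $\mathfrak p(\mathcal J)\le\mathfrak{fip}(\mathcal I,\mathcal J,\mathcal F)$; (2) $\operatorname{add}^*(\mathcal I)\le\mathfrak{fip}(\mathcal I,\mathcal J,\mathcal F)$.
   Context: An ideal on a set $X$ is a family of subsets of $X$ closed under finite unions and subsets, containing all finite subsets of $X$ and not containing $X$; $\mathcal J^+$ is the family of subsets of $X$ not in $\mathcal J$. $\mathcal I$ on $\omega$ is tall if every infinite $A\subseteq\omega$ contains an infinite $B\in\mathcal I$. For $A\notin\mathcal J$, $\mathcal J\restriction A=\{B\cap A:B\in\mathcal J\}$ (an ideal on $A$), and $\mathcal I\le_{\mathcal F}\mathcal J\restriction A$ means that there is $f\in\mathcal F$ with $f^{-1}[B]\cap A\in\mathcal J$ for every $B\in\mathcal I$ (functions in $\mathcal F$ are restricted to $A$). A nonempty family $\mathcal A\subseteq\mathcal P(\omega)$ has $\mathcal J^+$-FIP if $\bigcap F\in\mathcal J^+$ for each finite $F\subseteq\mathcal A$. A set $B\in\mathcal J^+$ is a $\mathcal J^+$-pseudointersection of $\mathcal A$ if $B\setminus A\in\mathcal J$ for each $A\in\mathcal A$. With $\mathfrak c=2^{\aleph_0}$: $\mathfrak p(\mathcal J)=\min(\{|\mathcal A|:\mathcal A$ has $\mathcal J^+$-FIP but has no $\mathcal J^+$-pseudointersection$\}\cup\{\mathfrak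 c^+\})$; $\operatorname{add}^*(\mathcal I)=\min\{|\mathcal A|:\mathcal A\subseteq\mathcal I$ and there is no $B\in\mathcal I$ with $A\setminus B$ finite for all $A\in\mathcal A\}$ (well defined for tall $\mathcal I$); $\mathfrak{fip}(\mathcal I,\mathcal J,\mathcal F)$ is the minimum of the set consisting of $\mathfrak c^+$ and all cardinals $|\mathcal A|$ such that $\mathcal A\subseteq\mathcal P(\omega)$ has $\mathcal J^+$-FIP and it is not true that for every $f\in\mathcal F$ there is $B\in\mathcal I$ such that $\mathcal A\cup\{f^{-1}[B]\}$ has $\mathcal J^+$-FIP. *)

theory Defs
  imports Main
begin

unbundle cardinal_syntax

definition ideal_on :: "'a set \<Rightarrow> 'a set set \<Rightarrow> bool" where
  "ideal_on X J \<longleftrightarrow> J \<subseteq> Pow X \<and>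
     (\<forall>A\<in>J. \<forall>B\<in>J. A \<union> B \<in> J) \<and>
     (\<forall>A\<in>J. \<forall>B. B \<subseteq> A \<longrightarrow> B \<in> J) \<and>
     (\<forall>A. A \<subseteq> X \<and> finite A \<longrightarrow> A \<in> J) \<and>
     X \<notin> J"

definition positive :: "nat set set \<Rightarrow> nat set set" where
  "positive J = {A. A \<notin> J}"

definition tall :: "nat set set \<Rightarrow> bool" where
  "tall I \<longleftrightarrow> (\<forall>A. infinite A \<longrightarrow> (\<exists>B. B \<subseteq> A \<and> infinite B \<and> B \<in> I))"

(* "I is F-below the restriction of J to A". *)
definition le_restrict ::
  "(nat \<Rightarrow> nat) set \<Rightarrow> nat set set \<Rightarrow> nat set set \<Rightarrow> nat set \<Rightarrow> bool" where
  "le_restrict F I J A \<longleftrightarrow> (\<exists>f\<in>F. \<forall>B\<in>I. f -` B \<inter> A \<in> J)"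

(* The empty subfamily is allowed for G; its intersection is the whole of nat. *)
definition has_FIP :: "nat set set \<Rightarrow> nat set set \<Rightarrow> bool" where
  "has_FIP J \<A> \<longleftrightarrow> \<A> \<noteq> {} \<and> (\<forall>G. G \<subseteq> \<A> \<and> finite G \<longrightarrow> \<Inter>G \<in> positive J)"

definition pseudointersection :: "nat set set \<Rightarrow> nat set set \<Rightarrow> nat set \<Rightarrow> bool" where
  "pseudointersection J \<A> B \<longleftrightarrow> B \<in> positive J \<and> (\<forall>A\<in>\<A>. B - A \<in> J)"

(* Cardinals are cardinal orders, identified up to =o; accordingly the minimum of a
   nonempty set of cardinals is determined up to =o. *)
definition min_card :: "'a rel set \<Rightarrow> 'a rel" where
  "min_card R = (SOME r. r \<in> R \<and> (\<forall>r'\<in>R. r \<le>o r'))"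

lemma min_card:
  assumes "R \<noteq> {}" and "\<forall>r\<in>R. Card_order r"
  shows "min_card R \<in> R" and "\<forall>r\<in>R. min_card R \<le>o r"
proof -
  have "\<exists>r. r \<in> R \<and> (\<forall>r'\<in>R. r \<le>o r')"
    using exists_minim_Card_order[OF assms] by blast
  from someI_ex[OF this] show "min_card R \<in> R" and "\<forall>r\<in>R. min_card R \<le>o r"
    unfolding min_card_def by blast+
qed

(* The successor of the cardinality of the continuum. It lives on nat set set, so the
   cardinals |\<A>| compared with it below are represented by the cardinal orders r on
   nat set set with r =o |\<A>|. *)
definition succ_continuum :: "nat set set rel" where
  "succ_continuum = cardSuc |UNIV :: nat set set|"

definition p_number :: "nat set set \<Rightarrow> nat set set rel" where
  "p_number J = min_card
     ({r. \<exists>\<A>. r =o |\<A> :: nat set set| \<and> has_FIP J \<A> \<and>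
             \<not> (\<exists>B. pseudointersection J \<A> B)}
      \<union> {succ_continuum})"

(* The set of cardinals is nonempty for a tall ideal I; otherwise the value is arbitrary. *)
definition add_star :: "nat set set \<Rightarrow> nat set rel" where
  "add_star I = min_card
     {r. \<exists>\<A>. r = |\<A> :: nat set set| \<and> \<A> \<subseteq> I \<and>
             \<not> (\<exists>B\<in>I. \<forall>A\<in>\<A>. finite (A - B))}"

definition fip_number ::
  "nat set set \<Rightarrow> nat set set \<Rightarrow> (nat \<Rightarrow> nat) set \<Rightarrow> nat set set rel" where
  "fip_number I J F = min_card
     ({r. \<exists>\<A>. r =o |\<A> :: nat set set| \<and> has_FIP J \<A> \<and>
             \<not> (\<forall>f\<in>F. \<exists>B\<in>I. has_FIP J (\<A> \<union> {f -` B}))}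
      \<union> {succ_continuum})"

end

theory Submission
  imports "HOL-Algebra.Free_Abelian_Groups" Defs
begin

text \<open>
  A pseudointersection \<open>P\<close> of a family with the finite intersection property is positive, so
  some \<open>f -` B \<inter> P\<close> with \<open>B \<in> I\<close> is positive, and \<open>f -` B\<close> can be added to the family. This
  gives the bound by the pseudointersection number.

  For the other bound, let \<open>\<A>\<close> have the property and fix \<open>f\<close>. For finite \<open>G \<subseteq> \<A>\<close> let \<open>N G\<close>
  be the set of those \<open>n\<close> whose fibre is positive on \<open>\<Inter>G\<close>; it decreases with \<open>G\<close>. If some
  \<open>N G0\<close> is empty, choose \<open>C G \<in> I\<close> for each \<open>G\<close> such that \<open>f -` C G\<close> is positive on \<open>\<Inter>G\<close>;
  for \<open>G \<supseteq> G0\<close>, finitely many points of \<open>C G\<close> do not matter. If all \<open>N G\<close> are infinite, choose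
  an infinite \<open>C G \<subseteq> N G\<close> in \<open>I\<close> by tallness. In both cases a set of \<open>I\<close> almost containing all
  \<open>C G\<close> works; it exists since there are at most \<open>|\<A>|\<close> (or finitely many) sets \<open>C G\<close>. In the
  remaining case some \<open>n\<close> belongs to all \<open>N G\<close>, and \<open>{n}\<close> works.
\<close>

lemma ideal_on_mono: "ideal_on X J \<Longrightarrow> A \<in> J \<Longrightarrow> B \<subseteq> A \<Longrightarrow> B \<in> J"
  unfolding ideal_on_def by blast

lemma ideal_on_Un: "ideal_on X J \<Longrightarrow> A \<in> J \<Longrightarrow> B \<in> J \<Longrightarrow> A \<union> B \<in> J"
  unfolding ideal_on_def by blast

lemma ideal_on_finite: "ideal_on X J \<Longrightarrow> A \<subseteq> X \<Longrightarrow> finite A \<Longrightarrow> A \<in> J"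
  unfolding ideal_on_def by blast

lemma ideal_on_UN:
  assumes "ideal_on X J" and "finite S" and "\<And>s. s \<in> S \<Longrightarrow> f s \<in> J"
  shows "(\<Union>s\<in>S. f s) \<in> J"
  using assms(2,3)
  by induction (auto intro: ideal_on_Un[OF assms(1)] ideal_on_finite[OF assms(1)])

lemma has_FIP_Un_singleton:
  assumes J: "ideal_on UNIV J"
    and "\<And>G. G \<subseteq> \<A> \<Longrightarrow> finite G \<Longrightarrow> \<Inter>G \<inter> X \<notin> J"
  shows "has_FIP J (\<A> \<union> {X})"
  unfolding has_FIP_def positive_def
proof (intro conjI allI impI)
  fix G assume G: "G \<subseteq> \<A> \<union> {X} \<and> finite G"
  \<comment> \<open>This covers both \<open>X\<close> in \<open>G\<close> and \<open>X\<close> not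
    in \<open>G\<close>: intersecting with \<open>X\<close> once more only shrinks the set.\<close>
  have "\<Inter>(G - {X}) \<inter> X \<notin> J"
    using G by (intro assms(2)) auto
  moreover have "\<Inter>(G - {X}) \<inter> X \<subseteq> \<Inter>G"
    by auto
  ultimately show "\<Inter>G \<in> {A. A \<notin> J}"
    using ideal_on_mono[OF J] by blast
qed simp

lemma has_FIP_extend_pseudointersection:
  assumes J: "ideal_on UNIV J"
    and nle: "\<forall>A. A \<notin> J \<longrightarrow> \<not> le_restrict F I J A"
    and P: "pseudointersection J \<A> P" and "f \<in> F"
  shows "\<exists>B\<in>I. has_FIP J (\<A> \<union> {f -` B})"
proof -
  have "P \<notin> J" and PA: "\<And>A. A \<in> \<A> \<Longrightarrow> P - A \<in> J"
    using P by (auto simp: pseudointersection_def positive_def)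
  then obtain B where B: "B \<in> I" "f -` B \<inter> P \<notin> J"
    using nle \<open>f \<in> F\<close> unfolding le_restrict_def by blast
  have "\<Inter>G \<inter> f -` B \<notin> J" if "G \<subseteq> \<A>" "finite G" for G
  proof
    assume "\<Inter>G \<inter> f -` B \<in> J"
    moreover have "(\<Union>A\<in>G. P - A) \<in> J"
      using that PA by (intro ideal_on_UN[OF J]) auto
    ultimately have "(\<Inter>G \<inter> f -` B) \<union> (\<Union>A\<in>G. P - A) \<in> J"
      by (rule ideal_on_Un[OF J])
    \<comment> \<open>A point of \<open>P\<close> outside every \<open>P - A\<close> with
      \<open>A\<close> in \<open>G\<close> lies in \<open>\<Inter>G\<close>.\<close>
    moreover have "f -` B \<inter> P \<subseteq> (\<Inter>G \<inter> f -` B) \<union> (\<Union>A\<in>G. P - A)"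
      by auto
    ultimately show False
      using B(2) ideal_on_mono[OF J] by blast
  qed
  with B(1) show ?thesis
    using has_FIP_Un_singleton[OF J] by blast
qed

text \<open>Makes \<open>I\<close> itself a witness for \<open>add_star I\<close>, so that its
  minimum is over a nonempty set. The complement of a \<open>B\<close> in \<open>I\<close> is
  infinite, so tallness puts into \<open>I\<close> an infinite set disjoint from
  \<open>B\<close>.\<close>

lemma tall_ideal_no_almost_cover:
  assumes I: "ideal_on UNIV I" and "tall I"
  shows "\<not> (\<exists>B\<in>I. \<forall>A\<in>I. finite (A - B))"
proof
  assume "\<exists>B\<in>I. \<forall>A\<in>I. finite (A - B)"
  then obtain B where B: "B \<in> I" "\<And>A. A \<in> I \<Longrightarrow> finite (A - B)"
    by blast
  have "infinite (- B)"
  proof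
    assume "finite (- B)"
    then have "B \<union> - B \<in> I"
      by (intro ideal_on_Un[OF I B(1)] ideal_on_finite[OF I]) simp_all
    then show False
      using I by (simp add: ideal_on_def Compl_partition)
  qed
  then obtain A where A: "A \<subseteq> - B" "infinite A" "A \<in> I"
    using \<open>tall I\<close> unfolding tall_def by blast
  moreover have "A - B = A"
    using A(1) by auto
  ultimately show False
    using B(2) by force
qed

lemma add_star_ordLeq:
  assumes "\<A> \<subseteq> I" and "\<not> (\<exists>B\<in>I. \<forall>A\<in>\<A>. finite (A - B))"
  shows "add_star I \<le>o |\<A>|"
  unfolding add_star_def
  by (rule bspec[OF min_card(2)]) (use assms in \<open>auto simp: card_of_Card_order\<close>)

lemma Card_order_add_star:
  assumes "ideal_on UNIV I" and "tall I"
  shows "Card_order (add_star I)"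
proof -
  let ?R = "{r. \<exists>\<A>. r = |\<A> :: nat set set| \<and> \<A> \<subseteq> I \<and>
             \<not> (\<exists>B\<in>I. \<forall>A\<in>\<A>. finite (A - B))}"
  have "min_card ?R \<in> ?R"
    using tall_ideal_no_almost_cover[OF assms]
    by (intro min_card(1)) (auto simp: card_of_Card_order)
  then show ?thesis
    unfolding add_star_def by (auto simp: card_of_Card_order)
qed

text \<open>An infinite \<open>\<A>\<close> has only \<open>|\<A>|\<close> finite subsets, so the
  sets \<open>C G\<close> are too few to witness \<open>add_star I\<close>. For finite
  \<open>\<A>\<close> this count fails, but the union of the finitely many \<open>C G\<close> is in
  \<open>I\<close>.\<close>

lemma almost_cover_finite_subset_indexed:
  assumes I: "ideal_on UNIV I" and "tall I"
    and less: "|\<A>| <o add_star I"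
    and C: "\<And>G. G \<subseteq> \<A> \<Longrightarrow> finite G \<Longrightarrow> C G \<in> I"
  shows "\<exists>B\<in>I. \<forall>G. G \<subseteq> \<A> \<and> finite G \<longrightarrow> finite (C G - B)"
proof -
  let ?Fin = "{G. G \<subseteq> \<A> \<and> finite G}"
  show ?thesis
  proof (cases "finite \<A>")
    case True
    then have "finite ?Fin"
      by simp
    then have "(\<Union>G\<in>?Fin. C G) \<in> I"
      using C by (intro ideal_on_UN[OF I]) auto
    moreover have "finite (C G - (\<Union>G\<in>?Fin. C G))" if "G \<subseteq> \<A> \<and> finite G" for G
    proof -
      have "C G - (\<Union>G\<in>?Fin. C G) = {}"
        using that by blast
      then show ?thesis
        by (simp only: finite.emptyI)
    qed
    ultimately show ?thesis
      by blast
  next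
    case False
    have "?Fin = Fpow \<A>"
      by (simp add: Fpow_def)
    then have "|C ` ?Fin| \<le>o |\<A>|"
      using ordLeq_ordIso_trans[OF card_of_image card_of_Fpow_infinite[OF False]] by simp
    then have "|C ` ?Fin| <o add_star I"
      using less by (rule ordLeq_ordLess_trans)
    then have "\<not> add_star I \<le>o |C ` ?Fin|"
      by (rule not_ordLess_ordLeq)
    moreover have "C ` ?Fin \<subseteq> I"
      using C by auto
    ultimately have "\<exists>B\<in>I. \<forall>A\<in>C ` ?Fin. finite (A - B)"
      using add_star_ordLeq by blast
    then show ?thesis
      by auto
  qed
qed

lemma has_FIP_extend_add_star:
  assumes I: "ideal_on UNIV I" and J: "ideal_on UNIV J" and "tall I"
    and nle: "\<forall>A. A \<notin> J \<longrightarrow> \<not> le_restrict F I J A"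
    and FIP: "has_FIP J \<A>" and less: "|\<A>| <o add_star I" and "f \<in> F"
  shows "\<exists>B\<in>I. has_FIP J (\<A> \<union> {f -` B})"
proof -
  define N where "N G = {n. \<Inter>G \<inter> f -` {n} \<notin> J}" for G
  note cover = almost_cover_finite_subset_indexed[OF I \<open>tall I\<close> less]
  have N_anti: "N G' \<subseteq> N G" if "G \<subseteq> G'" for G G'
  proof
    fix n assume "n \<in> N G'"
    moreover have "\<Inter>G' \<inter> f -` {n} \<subseteq> \<Inter>G \<inter> f -` {n}"
      using that by auto
    ultimately show "n \<in> N G"
      unfolding N_def using ideal_on_mono[OF J] by auto
  qed
  have "\<exists>B\<in>I. \<forall>G. G \<subseteq> \<A> \<and> finite G \<longrightarrow> \<Inter>G \<inter> f -` B \<notin> J"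
  proof -
    consider (empty) G0 where "G0 \<subseteq> \<A>" "finite G0" "N G0 = {}"
      | (inf) "\<And>G. G \<subseteq> \<A> \<Longrightarrow> finite G \<Longrightarrow> infinite (N G)"
      | (fin) G0 where "G0 \<subseteq> \<A>" "finite G0" "finite (N G0)"
          "\<And>G. G \<subseteq> \<A> \<Longrightarrow> finite G \<Longrightarrow> N G \<noteq> {}"
      by metis
    then show ?thesis
    proof cases
      case empty
      have "\<exists>B\<in>I. \<Inter>G \<inter> f -` B \<notin> J" if "G \<subseteq> \<A>" "finite G" for G
      proof -
        have "\<Inter>G \<notin> J"
          using that FIP by (auto simp: has_FIP_def positive_def)
        then have "\<exists>B\<in>I. f -` B \<inter> \<Inter>G \<notin> J"
          using nle \<open>f \<in> F\<close> unfolding le_restrict_def by blast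
        then show ?thesis
          by (simp only: Int_commute)
      qed
      then obtain C where C: "\<And>G. G \<subseteq> \<A> \<Longrightarrow> finite G \<Longrightarrow> C G \<in> I \<and> \<Inter>G \<inter> f -` C G \<notin> J"
        by (metis (no_types))
      obtain B where B: "B \<in> I" "\<And>G. G \<subseteq> \<A> \<Longrightarrow> finite G \<Longrightarrow> finite (C G - B)"
        using cover[of C] C by blast
      have "\<Inter>G \<inter> f -` B \<notin> J" if G: "G \<subseteq> \<A>" "finite G" for G
      proof
        assume *: "\<Inter>G \<inter> f -` B \<in> J"
        \<comment> \<open>On \<open>\<Inter>G0\<close> every fibre of \<open>f\<close> is in
          \<open>J\<close>, so after passing to \<open>?H\<close> the finitely many points of
          \<open>C ?H\<close> outside \<open>B\<close> contribute only a set in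
          \<open>J\<close>.\<close>
        let ?H = "G \<union> G0"
        have H: "?H \<subseteq> \<A>" "finite ?H"
          using G empty by auto
        have "(\<Union>n\<in>C ?H - B. \<Inter>G0 \<inter> f -` {n}) \<in> J"
          using B(2)[OF H] empty(3) by (intro ideal_on_UN[OF J]) (auto simp: N_def)
        with * have "(\<Inter>G \<inter> f -` B) \<union> (\<Union>n\<in>C ?H - B. \<Inter>G0 \<inter> f -` {n}) \<in> J"
          by (rule ideal_on_Un[OF J])
        moreover have "\<Inter>?H \<inter> f -` C ?H \<subseteq> (\<Inter>G \<inter> f -` B) \<union> (\<Union>n\<in>C ?H - B. \<Inter>G0 \<inter> f -` {n})"
          by auto
        ultimately show False
          using C[OF H] ideal_on_mono[OF J] by blast
      qed
      with B(1) show ?thesis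
        by blast
    next
      case inf
      then have "\<forall>G. \<exists>B. G \<subseteq> \<A> \<and> finite G \<longrightarrow> B \<in> I \<and> B \<subseteq> N G \<and> infinite B"
        using \<open>tall I\<close> unfolding tall_def by blast
      from choice[OF this] obtain C where
        C: "\<And>G. G \<subseteq> \<A> \<Longrightarrow> finite G \<Longrightarrow> C G \<in> I \<and> C G \<subseteq> N G \<and> infinite (C G)"
        by blast
      obtain B where B: "B \<in> I" "\<And>G. G \<subseteq> \<A> \<Longrightarrow> finite G \<Longrightarrow> finite (C G - B)"
        using cover[of C] C by blast
      have "\<Inter>G \<inter> f -` B \<notin> J" if G: "G \<subseteq> \<A>" "finite G" for G
      proof -
        \<comment> \<open>An infinite set is not contained in a finite one, so \<open>B\<close>
          meets \<open>C G\<close>; the fibre of one common point is already positive on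
          \<open>\<Inter>G\<close>.\<close>
        have "\<not> C G \<subseteq> C G - B"
          using B(2)[OF G] C[OF G] finite_subset by blast
        then obtain n where "n \<in> N G" "n \<in> B"
          using C[OF G] by blast
        moreover have "\<Inter>G \<inter> f -` {n} \<subseteq> \<Inter>G \<inter> f -` B"
          using \<open>n \<in> B\<close> by auto
        ultimately show ?thesis
          unfolding N_def using ideal_on_mono[OF J] by blast
      qed
      with B(1) show ?thesis
        by blast
    next
      case fin
      have "\<exists>n. \<forall>G. G \<subseteq> \<A> \<and> finite G \<longrightarrow> n \<in> N G"
      proof (rule ccontr)
        assume "\<not> ?thesis"
        then have "\<forall>n. \<exists>G. G \<subseteq> \<A> \<and> finite G \<and> n \<notin> N G"
          by blast
        from choice[OF this] obtain g where g: "\<And>n. g n \<subseteq> \<A> \<and> finite (g n) \<and> n \<notin> N (g n)"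
          by blast
        \<comment> \<open>Compactness: \<open>?H\<close> is finite because \<open>N G0\<close> is.
          By antitonicity \<open>N ?H\<close> lies in \<open>N G0\<close> but omits each
          \<open>n\<close> there, since \<open>N (g n)\<close> does; so it would be empty.\<close>
        let ?H = "G0 \<union> (\<Union>n\<in>N G0. g n)"
        have "?H \<subseteq> \<A>" "finite ?H"
          using fin g by auto
        then obtain n where n: "n \<in> N ?H"
          using fin(4) by blast
        then have "n \<in> N G0"
          using N_anti[of G0 ?H] by blast
        then show False
          using n g N_anti[of "g n" ?H] by blast
      qed
      then obtain n where "\<And>G. G \<subseteq> \<A> \<Longrightarrow> finite G \<Longrightarrow> n \<in> N G"
        by blast
      then show ?thesis
        by (intro bexI[of _ "{n}"] ideal_on_finite[OF I]) (auto simp: N_def)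
    qed
  qed
  then show ?thesis
    using has_FIP_Un_singleton[OF J] by blast
qed

lemma Card_order_succ_continuum: "Card_order succ_continuum"
  unfolding succ_continuum_def by (rule cardSuc_Card_order) (rule card_of_Card_order)

text \<open>Needed when \<open>fip_number\<close> takes its default value. The witness
  \<open>I\<close> for \<open>add_star I\<close> has at most continuum many members.\<close>

lemma add_star_ordLeq_succ_continuum:
  assumes "ideal_on UNIV I" and "tall I"
  shows "add_star I \<le>o succ_continuum"
proof -
  have "add_star I \<le>o |I|"
    using tall_ideal_no_almost_cover[OF assms] by (intro add_star_ordLeq) auto
  also have "|I| \<le>o |UNIV :: nat set set|"
    by (rule card_of_mono1) simp
  also have "|UNIV :: nat set set| \<le>o succ_continuum"
    unfolding succ_continuum_def
    by (rule ordLess_imp_ordLeq[OF cardSuc_greater]) (rule card_of_Card_order)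
  finally show ?thesis .
qed

text \<open>The arbitrary \<open>P\<close> lets this serve both \<open>p_number\<close> and
  \<open>fip_number\<close>. The default value makes the set nonempty, and \<open>=o\<close>
  transfers being a cardinal order from \<open>|\<A>|\<close> to \<open>r\<close>.\<close>

lemma min_card_Un_succ_continuum:
  fixes P :: "nat set set \<Rightarrow> bool"
  defines "R \<equiv> {r. \<exists>\<A>. r =o |\<A>| \<and> P \<A>} \<union> {succ_continuum}"
  shows "min_card R \<in> R" and "\<And>r. r \<in> R \<Longrightarrow> min_card R \<le>o r"
proof -
  have "\<forall>r\<in>R. Card_order r"
    using Card_order_succ_continuum Card_order_ordIso[OF card_of_Card_order]
    unfolding R_def by blast
  moreover have "R \<noteq> {}"
    unfolding R_def by blast
  ultimately show "min_card R \<in> R" and "\<And>r. r \<in> R \<Longrightarrow> min_card R \<le>o r"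
    using min_card[of R] by blast+
qed

theorem theorem4p1:
  fixes F :: "(nat \<Rightarrow> nat) set" and I J :: "nat set set"
  assumes "ideal_on UNIV I" and "ideal_on UNIV J"
    and "tall I"
    and "\<forall>A. A \<notin> J \<longrightarrow> \<not> le_restrict F I J A"
  shows "p_number J \<le>o fip_number I J F \<and> add_star I \<le>o fip_number I J F"
proof -
  have "fip_number I J F \<in>
      {r. \<exists>\<A>. r =o |\<A> :: nat set set| \<and> has_FIP J \<A> \<and>
             \<not> (\<forall>f\<in>F. \<exists>B\<in>I. has_FIP J (\<A> \<union> {f -` B}))} \<union> {succ_continuum}"
    unfolding fip_number_def by (rule min_card_Un_succ_continuum(1))
  then consider (fam) \<A> f where "fip_number I J F =o |\<A>|" "has_FIP J \<A>" "f \<in> F"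
      "\<not> (\<exists>B\<in>I. has_FIP J (\<A> \<union> {f -` B}))"
    | (succ) "fip_number I J F = succ_continuum"
    by blast
  then show ?thesis
  proof cases
    case fam
    \<comment> \<open>A pseudointersection would give the extension that fails for \<open>f\<close>;
      hence \<open>\<A>\<close> also competes in the minimum for \<open>p_number J\<close>.\<close>
    have "\<not> (\<exists>B. pseudointersection J \<A> B)"
      using has_FIP_extend_pseudointersection[OF assms(2,4)] fam(3,4) by blast
    with fam(1,2) have "p_number J \<le>o fip_number I J F"
      unfolding p_number_def by (intro min_card_Un_succ_continuum(2)) blast
    moreover have "\<not> |\<A>| <o add_star I"
      using has_FIP_extend_add_star[OF assms fam(2) _ fam(3)] fam(4) by blast
    then have "add_star I \<le>o |\<A>|"
      using Card_order_add_star[OF assms(1,3)] card_of_Well_order card_order_on_well_order_on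
        not_ordLess_iff_ordLeq by blast
    then have "add_star I \<le>o fip_number I J F"
      using ordIso_symmetric[OF fam(1)] by (rule ordLeq_ordIso_trans)
    ultimately show ?thesis ..
  next
    case succ
    have "p_number J \<le>o succ_continuum"
      unfolding p_number_def by (intro min_card_Un_succ_continuum(2)) blast
    with succ add_star_ordLeq_succ_continuum[OF assms(1,3)] show ?thesis
      by simp
  qed
qed

end
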